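(* Let $p$ be an odd prime, let $q$ be a power of $p$, let $a\in\mathbb{F}_q^*$, and let $k,d$ be positive integers. The polynomial $\mathfrak{D}_{k,2}=D_{k,2}(X^d,a)-D_{k,2}(0,a)\in\mathbb{F}_q[X]$ is a Dembowski-Ostrom (DO) polynomial over $\mathbb{F}_q$ if and only if one of the following holds: (i) $k=1$ and $d=p^n(p^{\alpha}+1)$ for some non-negative integers $\alpha$ and $n$. (ii) $k=2$ and $d=p^n(p^{\alpha}+1)/2$ for some non-negative integers $\alpha$ and $n$. (iii) $k=3$ and either (a) $p=3$ and $d=p^n(p^{\alpha}+1)$ for some non-negative integers $\alpha$ and $n$; or (b) $p=5$ and $d=2p^n$ for some non-negative integer $n$. (iv) $k\in\{4,6,12\}$, $p=3$ and $d=p^n$ for some non-negative integer $n$. (v) $k=5$ and either (a) $p=3$ and $d=2p^n$ for some non-negative integer $n$; or (b) $p=5$ and $d=2p^n$ for some non-negative integer $n$. (vi) $k=9$, $p=3$ and $d=4p^n$ for some non-negative integer $n$.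
   Context: $\mathbb{F}_q$ is the finite field with $q$ elements and $\mathbb{F}_q^*$ is its multiplicative group of nonzero elements. For integers $k\ge 1$ and $m\ge 0$ and $a\in\mathbb{F}_q$, the $k$-th Dickson polynomial of the $(m+1)$-th kind is $$D_{k,m}(X,a)=\sum_{i=0}^{\lfloor k/2\rfloor}\frac{k-mi}{k-i}\binom{k-i}{i}(-a)^iX^{k-2i}\in\mathbb{F}_q[X],$$ where each coefficient $\frac{k-mi}{k-i}\binom{k-i}{i}$ is an integer, interpreted modulo $p$. For a positive integer $d$, $\mathfrak{D}_{k,m}:=D_{k,m}(X^d,a)-D_{k,m}(0,a)$, i.e. $D_{k,m}(X^d,a)$ with its constant term removed; explicitly $\mathfrak{D}_{k,m}=\sum_{i=0}^{\lfloor (k-1)/2\rfloor}\frac{k-mi}{k-i}\binom{k-i}{i}(-a)^iX^{(k-2i)d}$. A Dembowski-Ostrom (DO) polynomial over $\mathbb{F}_q$ ($q$ a power of $p$) is a polynomial in $\mathbb{F}_q[X]$ of the form $\sum_{i,j}a_{ij}X^{p^i+p^j}$ (finite sum over non-negative integers $i,j$, with $a_{ij}\in\mathbb{F}_q$). Polynomials are considered as formal polynomials, not reduced modulo $X^q-X$. *)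

theory Defs
  imports "HOL-Computational_Algebra.Computational_Algebra"
begin

text \<open>
  The integer coefficient of the Dickson polynomials. The division is exact for
  \<open>k \<ge> 1\<close> and \<open>i \<le> k div 2\<close>; see the two lemmas below.
\<close>

definition dickson_coeff :: "nat \<Rightarrow> nat \<Rightarrow> nat \<Rightarrow> int" where
  "dickson_coeff k m i = (int k - int m * int i) * int ((k - i) choose i) div int (k - i)"

lemma dickson_coeff_exact:
  assumes "k > 0" "i \<le> k div 2"
  shows "int (k - i) dvd (int k - int m * int i) * int ((k - i) choose i)"
proof (cases i)
  case 0
  then show ?thesis by simp
next
  case (Suc j)
  define n where "n = k - i"
  have k: "int k = int n + int i" and n: "n > 0"
    using assms by (auto simp: n_def)
  have "i * (n choose i) = n * ((n - 1) choose j)"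
    using n Suc Suc_times_binomial_eq[of "n - 1" j] by (simp add: mult.commute)
  then have "int i * int (n choose i) = int n * int ((n - 1) choose j)"
    by (metis of_nat_mult)
  then have "(int k - int m * int i) * int (n choose i)
      = int n * (int (n choose i) + (1 - int m) * int ((n - 1) choose j))"
    by (simp add: k algebra_simps)
  then show ?thesis
    by (simp add: n_def)
qed

lemma of_int_dickson_coeff:
  assumes "k > 0" "i \<le> k div 2"
  shows "(of_int (dickson_coeff k m i) :: rat) =
    (of_nat k - of_nat m * of_nat i) / of_nat (k - i) * of_nat ((k - i) choose i)"
  using dickson_coeff_exact[OF assms, of m] by (simp add: dickson_coeff_def of_int_div)

definition dickson_poly :: "nat \<Rightarrow> nat \<Rightarrow> 'a::comm_ring_1 \<Rightarrow> 'a poly" where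
  "dickson_poly k m a = (\<Sum>i\<le>k div 2. monom (of_int (dickson_coeff k m i) * (- a) ^ i) (k - 2 * i))"

definition dickson_frak :: "nat \<Rightarrow> nat \<Rightarrow> nat \<Rightarrow> 'a::comm_ring_1 \<Rightarrow> 'a poly" where
  "dickson_frak d k m a = dickson_poly k m a \<circ>\<^sub>p monom 1 d - [:poly (dickson_poly k m a) 0:]"

text \<open>Here \<open>p\<close> is meant to be the characteristic of the coefficient field.\<close>

definition DO_poly :: "nat \<Rightarrow> 'a::comm_semiring_1 poly \<Rightarrow> bool" where
  "DO_poly p f \<longleftrightarrow> (\<exists>(I :: (nat \<times> nat) set) (c :: nat \<Rightarrow> nat \<Rightarrow> 'a).
     finite I \<and> f = (\<Sum>(i, j)\<in>I. monom (c i j) (p ^ i + p ^ j)))"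

end

theory Submission
  imports Defs
begin

text \<open>
  In the third kind the coefficient of index \<open>i\<close> collapses:
  \<open>(k - 2i) / (k - i)\<close> times \<open>(k - i choose i)\<close> is \<open>(k - i - 1 choose i)\<close>. Writing \<open>s = k - 2i\<close> for the
  exponent, the polynomial is the sum of the monomials \<open>(s + i - 1 choose i) (-a)^i X^(s d)\<close> over
  \<open>s > 0\<close>, \<open>s + 2i = k\<close>. The exponents are distinct and \<open>a\<close> is a unit, so it is a DO polynomial exactly
  when \<open>s d\<close> is a sum of two powers of \<open>p\<close> for each \<open>s\<close> whose binomial coefficient is prime to \<open>p\<close>
  (\<open>DO_poly_dickson_frak_iff_admissible\<close>). What remains is elementary number theory.

  For odd \<open>p\<close>, \<open>p n\<close> is a sum of two powers of \<open>p\<close> iff \<open>n\<close> is, so one may divide \<open>d\<close> by its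
  power of \<open>p\<close> and assume that \<open>p\<close> does not divide \<open>d\<close>. A sum of two powers that is prime to \<open>p\<close> has the
  form \<open>p^j + 1\<close>. Hence two such sums \<open>x < y\<close> both prime to \<open>p\<close> differ by \<open>p^j - p^i\<close>, and if
  \<open>y - x\<close> is prime to \<open>p\<close> too, then \<open>i = 0\<close> and \<open>x = 2\<close> (\<open>two_power_sum_gap\<close>). Applied to two exponents
  near the top this pins down \<open>k\<close> and \<open>d\<close> whenever it applies.

  The coefficients of index 1, 2, ... are \<open>s\<close>, \<open>s(s + 1)/2\<close>, ..., so their
  divisibility by \<open>p\<close> is visible from the residue of \<open>k\<close>. The gap argument is applied to the exponents
  \<open>k, k - 2\<close>, or to \<open>k, k - 4\<close> if \<open>p\<close> divides \<open>k - 2\<close>. If \<open>p\<close> divides \<open>k\<close>, the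
  exponent \<open>k d\<close> is no longer prime to \<open>p\<close>. For odd \<open>k\<close> the coefficient of \<open>X^d\<close> is 1, so
  \<open>d = p^\<alpha> + 1\<close>, and reducing \<open>k d = (k - 2) d + 2 d\<close> modulo \<open>p\<close> leaves only \<open>p = 3\<close> and \<open>p = 5\<close>.
  For even \<open>k\<close> the gap argument on \<open>k - 2, k - 4\<close> leaves only \<open>p = 3\<close>. The remaining
  families are equations between sums of powers of 3 or 5; they are settled by comparing sizes and
  residues, together with the exponents \<open>k - 4\<close>, \<open>k - 6\<close> and \<open>k - 12\<close>. Conversely, each listed \<open>k\<close> involves at
  most six exponents, which are checked one by one.
\<close>

section \<open>Sums of two powers\<close>

definition two_power_sum :: "nat \<Rightarrow> nat \<Rightarrow> bool" where
  "two_power_sum p n \<longleftrightarrow> (\<exists>i j. n = p ^ i + p ^ j)"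

lemma two_power_sum_powers: "two_power_sum p (p ^ i + p ^ j)"
  by (auto simp: two_power_sum_def)

lemma two_power_sum_coprimeE:
  assumes "two_power_sum p n" and "\<not> p dvd n"
  obtains j where "n = p ^ j + 1"
proof -
  obtain i j where n: "n = p ^ i + p ^ j"
    using assms(1) by (auto simp: two_power_sum_def)
  have "i = 0 \<or> j = 0"
    using assms(2) n by (cases i; cases j) auto
  with n that show ?thesis by auto
qed

text \<open>
  If \<open>p n = p^i + p^j\<close> with \<open>i = 0\<close> or \<open>j = 0\<close>, the right-hand side is 1 or 2 modulo \<open>p\<close>; so both
  exponents are positive and one factor \<open>p\<close> cancels. For \<open>p = 2\<close> this fails, as \<open>2 = 1 + 1\<close> shows.
\<close>

lemma two_power_sum_mult_iff:
  assumes "prime p" "odd p"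
  shows "two_power_sum p (p * n) \<longleftrightarrow> two_power_sum p n"
proof
  assume "two_power_sum p (p * n)"
  then obtain i j where ij: "p * n = p ^ i + p ^ j"
    by (auto simp: two_power_sum_def)
  have p: "p > 2"
    using assms prime_gt_1_nat[of p] by (cases "p = 2") auto
  have "p dvd p ^ i + p ^ j"
    by (metis ij dvd_triv_left)
  moreover have "\<not> p dvd Suc (p * x)" for x
    using p dvd_add_right_iff[of p "p * x" 1] by simp
  moreover have "\<not> p dvd 2"
    using p by (auto dest: dvd_imp_le)
  ultimately have "i > 0 \<and> j > 0"
    by (cases i; cases j) (simp_all add: numeral_2_eq_2)
  then obtain i' j' where "i = Suc i'" "j = Suc j'"
    by (auto simp: gr0_conv_Suc)
  with ij have "p * n = p * (p ^ i' + p ^ j')"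
    by (simp add: algebra_simps)
  with p have "n = p ^ i' + p ^ j'"
    by (simp only: mult_cancel1) auto
  then show "two_power_sum p n"
    by (auto simp: two_power_sum_def)
next
  assume "two_power_sum p n"
  then obtain i j where "n = p ^ i + p ^ j"
    by (auto simp: two_power_sum_def)
  then have "p * n = p ^ Suc i + p ^ Suc j"
    by (simp add: algebra_simps)
  then show "two_power_sum p (p * n)"
    unfolding two_power_sum_def by blast
qed

text \<open>
  Both numbers are of the form \<open>p^i + 1\<close>; a positive \<open>i\<close> for the smaller one would make the
  difference divisible by \<open>p\<close>.
\<close>

lemma two_power_sum_gap:
  assumes "p > 0" and "two_power_sum p x" and "two_power_sum p y" and "y = x + z"
    and "\<not> p dvd x" and "\<not> p dvd y" and "\<not> p dvd z"
  shows "x = 2"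
proof -
  obtain i where i: "x = p ^ i + 1"
    using two_power_sum_coprimeE assms(2,5) by blast
  obtain j where j: "y = p ^ j + 1"
    using two_power_sum_coprimeE assms(3,6) by blast
  have ij: "p ^ j = p ^ i + z"
    using i j \<open>y = x + z\<close> by simp
  have "i = 0"
  proof (rule ccontr)
    assume "i \<noteq> 0"
    show False
    proof (cases "j = 0")
      case True
      then have "p ^ i + z = 1"
        using ij by simp
      moreover have "p ^ i > 0"
        using assms(1) by simp
      moreover have "z \<noteq> 0"
        using assms(7) by (metis dvd_0_right)
      ultimately show False
        by linarith
    next
      case False
      then have "p dvd p ^ i + z" "p dvd p ^ i"
        using ij \<open>i \<noteq> 0\<close> by (metis dvd_power neq0_conv)+
      then show False
        using assms(7) by (simp add: dvd_add_right_iff)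
    qed
  qed
  then show ?thesis
    using i by simp
qed

section \<open>DO polynomials and the support of the Dickson polynomial\<close>

text \<open>
  The combinatorial content of the DO property for \<open>k\<close> and \<open>d\<close>. Indexing by the exponent \<open>s\<close> instead of
  by \<open>k\<close> and \<open>i\<close> avoids truncated subtraction and turns the coefficient of index \<open>i\<close> into
  \<open>s (s + 1) \<cdots> (s + i - 1) / i!\<close>.
\<close>

definition admissible :: "nat \<Rightarrow> nat \<Rightarrow> nat \<Rightarrow> bool" where
  "admissible p k d \<longleftrightarrow> (\<forall>s i. s > 0 \<longrightarrow> k = s + 2 * i \<longrightarrow>
     \<not> p dvd (s + i - 1 choose i) \<longrightarrow> two_power_sum p (s * d))"

text \<open>
  A pair \<open>(i, j)\<close> in the index set determines its exponent \<open>p^i + p^j\<close>, but not conversely. To write \<open>f\<close>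
  as a DO sum, one pair is chosen for each exponent that occurs.
\<close>

lemma DO_poly_iff_support:
  fixes f :: "'a::comm_semiring_1 poly"
  shows "DO_poly p f \<longleftrightarrow> (\<forall>N. coeff f N \<noteq> 0 \<longrightarrow> two_power_sum p N)"
proof
  assume "DO_poly p f"
  then obtain I and c :: "nat \<Rightarrow> nat \<Rightarrow> 'a" where
    f: "f = (\<Sum>(i, j)\<in>I. monom (c i j) (p ^ i + p ^ j))"
    by (auto simp: DO_poly_def)
  show "\<forall>N. coeff f N \<noteq> 0 \<longrightarrow> two_power_sum p N"
  proof (intro allI impI)
    fix N assume "coeff f N \<noteq> 0"
    then have "(\<Sum>(i, j)\<in>I. if p ^ i + p ^ j = N then c i j else 0) \<noteq> 0"
      by (simp add: f coeff_sum case_prod_unfold)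
    then obtain x where "(case x of (i, j) \<Rightarrow> if p ^ i + p ^ j = N then c i j else 0) \<noteq> 0"
      by (meson sum.neutral)
    then show "two_power_sum p N"
      by (auto simp: two_power_sum_def split: prod.splits if_splits)
  qed
next
  assume "\<forall>N. coeff f N \<noteq> 0 \<longrightarrow> two_power_sum p N"
  then obtain u v where uv: "\<And>N. coeff f N \<noteq> 0 \<Longrightarrow> N = p ^ u N + p ^ v N"
    unfolding two_power_sum_def by metis
  define A where "A = {N. coeff f N \<noteq> 0}"
  have A: "finite A"
    using MOST_coeff_eq_0[of f] by (simp add: A_def eventually_cofinite)
  have inj: "inj_on (\<lambda>N. (u N, v N)) A"
    by (rule inj_onI) (metis (mono_tags) A_def Pair_inject mem_Collect_eq uv)
  have "f = (\<Sum>N\<in>A. monom (coeff f N) N)"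
    using A by (intro poly_eqI) (simp add: coeff_sum A_def)
  also have "\<dots> = (\<Sum>N\<in>A. monom (coeff f (p ^ u N + p ^ v N)) (p ^ u N + p ^ v N))"
    using uv by (intro sum.cong) (auto simp: A_def)
  also have "\<dots> = (\<Sum>(i, j)\<in>(\<lambda>N. (u N, v N)) ` A. monom (coeff f (p ^ i + p ^ j)) (p ^ i + p ^ j))"
    by (simp add: sum.reindex[OF inj])
  finally show "DO_poly p f"
    unfolding DO_poly_def using A
    by (intro exI[of _ "(\<lambda>N. (u N, v N)) ` A"] exI[of _ "\<lambda>i j. coeff f (p ^ i + p ^ j)"]) simp
qed

lemma dickson_coeff_third_kind:
  assumes "s > 0"
  shows "dickson_coeff (s + 2 * i) 2 i = int (s + i - 1 choose i)"
proof -
  have "s * (s + i choose i) = (s + i) * (s + i - 1 choose i)"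
    using binomial_absorb_comp[of "s + i" i] by simp
  then have "int s * int (s + i choose i) = int (s + i) * int (s + i - 1 choose i)"
    by (metis of_nat_mult)
  moreover have "s + 2 * i - i = s + i" "int (s + 2 * i) - int 2 * int i = int s"
    by simp_all
  ultimately show ?thesis
    using assms by (simp only: dickson_coeff_def nonzero_mult_div_cancel_left)
qed

lemma monom_pcompose_monom:
  "monom (c :: 'a :: comm_ring_1) n \<circ>\<^sub>p monom 1 d = monom c (n * d)"
  by (induction n) (simp_all add: monom_0 monom_Suc pcompose_pCons mult_monom mult.commute)

lemma coeff_dickson_frak:
  fixes a :: "'a::comm_ring_1"
  assumes "N > 0"
  shows "coeff (dickson_frak d k m a) N =
    (\<Sum>i | i \<le> k div 2 \<and> (k - 2 * i) * d = N. of_int (dickson_coeff k m i) * (- a) ^ i)"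
proof -
  have "coeff (dickson_frak d k m a) N =
      (\<Sum>i\<le>k div 2. if (k - 2 * i) * d = N then of_int (dickson_coeff k m i) * (- a) ^ i else 0)"
    using assms
    by (simp add: dickson_frak_def dickson_poly_def pcompose_sum monom_pcompose_monom coeff_sum
        coeff_pCons split: nat.splits)
  also have "\<dots> = (\<Sum>i | i \<le> k div 2 \<and> (k - 2 * i) * d = N. of_int (dickson_coeff k m i) * (- a) ^ i)"
    by (subst sum.inter_filter [symmetric]) (auto intro!: sum.cong)
  finally show ?thesis .
qed

lemma coeff_dickson_frak_0:
  fixes a :: "'a::comm_ring_1"
  assumes "d > 0"
  shows "coeff (dickson_frak d k m a) 0 = 0"
  using assms by (simp add: dickson_frak_def poly_0_coeff_0 [symmetric] poly_pcompose poly_monom zero_power)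

lemma coeff_dickson_frak_exponent:
  fixes a :: "'a::comm_ring_1"
  assumes "d > 0" "s > 0"
  shows "coeff (dickson_frak d (s + 2 * i) 2 a) (s * d) = of_nat (s + i - 1 choose i) * (- a) ^ i"
proof -
  have "{j. j \<le> (s + 2 * i) div 2 \<and> (s + 2 * i - 2 * j) * d = s * d} = {i}"
    using assms by auto
  then show ?thesis
    using assms by (simp add: coeff_dickson_frak dickson_coeff_third_kind)
qed

lemma dickson_frak_support:
  fixes a :: "'a::comm_ring_1"
  assumes "d > 0" "coeff (dickson_frak d k m a) N \<noteq> 0"
  obtains s i where "s > 0" "k = s + 2 * i" "N = s * d"
proof -
  have N: "N > 0"
    using assms coeff_dickson_frak_0 by (cases N) auto
  with assms(2) have "{i. i \<le> k div 2 \<and> (k - 2 * i) * d = N} \<noteq> {}"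
    unfolding coeff_dickson_frak[OF N] by (metis sum.empty)
  then obtain i where i: "i \<le> k div 2" "(k - 2 * i) * d = N"
    by blast
  show ?thesis
    by (rule that[of "k - 2 * i" i]) (use i N in \<open>auto intro: Nat.gr0I\<close>)
qed

text \<open>
  The characteristic is a prime dividing the number of elements: translation by 1 permutes the field,
  so the sum of all elements does not change when 1 is added to each of them.
\<close>

lemma finite_field_of_nat_eq_0_iff:
  assumes "prime p" and "card (UNIV :: 'a :: finite_field set) = p ^ e"
  shows "(of_nat n :: 'a) = 0 \<longleftrightarrow> p dvd n"
proof -
  have "prime CHAR('a)"
    by (simp add: prime_CHAR_semidom)
  moreover have "CHAR('a) dvd p ^ e"
  proof -
    have "(\<Sum>x\<in>UNIV. x :: 'a) = (\<Sum>x\<in>UNIV. x + 1)"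
      by (rule sum.reindex_bij_witness[of _ "\<lambda>x. x + 1" "\<lambda>x. x - 1"]) auto
    then have "(of_nat (card (UNIV :: 'a set)) :: 'a) = 0"
      by (simp add: sum.distrib)
    then show ?thesis
      by (simp only: assms(2) of_nat_eq_0_iff_char_dvd)
  qed
  ultimately have "CHAR('a) = p"
    using assms(1) prime_dvd_power primes_dvd_imp_eq by blast
  then show ?thesis
    by (simp add: of_nat_eq_0_iff_char_dvd)
qed

text \<open>
  Since \<open>- a\<close> is a unit, the monomial \<open>X^(s d)\<close> occurs iff its binomial coefficient is prime to \<open>p\<close>.
\<close>

lemma DO_poly_dickson_frak_iff_admissible:
  fixes a :: "'a::finite_field"
  assumes "prime p" and "card (UNIV :: 'a set) = p ^ e" and "a \<noteq> 0" and "d > 0"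
  shows "DO_poly p (dickson_frak d k 2 a) \<longleftrightarrow> admissible p k d"
proof
  assume "DO_poly p (dickson_frak d k 2 a)"
  then show "admissible p k d"
    using assms coeff_dickson_frak_exponent[OF \<open>d > 0\<close>, of _ _ a]
    by (auto simp: admissible_def DO_poly_iff_support finite_field_of_nat_eq_0_iff)
next
  assume adm: "admissible p k d"
  have "two_power_sum p N" if N: "coeff (dickson_frak d k 2 a) N \<noteq> 0" for N
  proof -
    obtain s i where si: "s > 0" "k = s + 2 * i" "N = s * d"
      using dickson_frak_support[OF \<open>d > 0\<close> N] by blast
    then have "\<not> p dvd (s + i - 1 choose i)"
      using N coeff_dickson_frak_exponent[OF \<open>d > 0\<close> \<open>s > 0\<close>, of i a]
        finite_field_of_nat_eq_0_iff[OF assms(1,2)] by auto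
    with adm si show ?thesis
      by (auto simp: admissible_def)
  qed
  then show "DO_poly p (dickson_frak d k 2 a)"
    by (simp add: DO_poly_iff_support)
qed

section \<open>Consequences of single exponents\<close>

lemma admissibleD:
  assumes "admissible p (s + 2 * i) d" "s > 0" "\<not> p dvd (s + i - 1 choose i)"
  shows "two_power_sum p (s * d)"
  using assms by (auto simp: admissible_def)

text \<open>
  This is the normalization that allows \<open>d\<close> to be taken prime to \<open>p\<close>.
\<close>

lemma admissible_mult_power_iff:
  assumes "prime p" "odd p"
  shows "admissible p k (p ^ v * d) \<longleftrightarrow> admissible p k d"
proof (induction v)
  case (Suc v)
  have "s * (p ^ Suc v * d) = p * (s * (p ^ v * d))" for s
    by simp
  then have "admissible p k (p ^ Suc v * d) \<longleftrightarrow> admissible p k (p ^ v * d)"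
    unfolding admissible_def using two_power_sum_mult_iff[OF assms] by presburger
  with Suc show ?case by simp
qed simp

lemma binomial_absorption_shift:
  fixes n :: nat
  assumes "n = m + 1" "i = j + 1"
  shows "i * (n choose i) = n * (m choose j)"
  using Suc_times_binomial_eq[of m j] assms by (simp add: mult.commute)

lemma choose_2_rising: "2 * (s + 1 choose 2) = s * (s + 1)"
  using binomial_absorption_shift[of "s + 1" s 2 1] by simp

lemma choose_3_rising: "6 * (s + 2 choose 3) = s * (s + 1) * (s + 2)"
proof -
  have 3: "3 * (s + 2 choose 3) = (s + 2) * (s + 1 choose 2)"
    by (rule binomial_absorption_shift) simp_all
  have "6 * (s + 2 choose 3) = (s + 2) * (2 * (s + 1 choose 2))"
    using 3 by simp
  then show ?thesis
    by (simp only: choose_2_rising mult_ac)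
qed

lemma choose_6_rising:
  "720 * (s + 5 choose 6) = s * (s + 1) * (s + 2) * (s + 3) * (s + 4) * (s + 5)"
proof -
  have 4: "4 * (s + 3 choose 4) = (s + 3) * (s + 2 choose 3)"
    by (rule binomial_absorption_shift) simp_all
  have 5: "5 * (s + 4 choose 5) = (s + 4) * (s + 3 choose 4)"
    by (rule binomial_absorption_shift) simp_all
  have 6: "6 * (s + 5 choose 6) = (s + 5) * (s + 4 choose 5)"
    by (rule binomial_absorption_shift) simp_all
  have "720 * (s + 5 choose 6) = 120 * (6 * (s + 5 choose 6))"
    by simp
  also have "\<dots> = 24 * (s + 5) * (5 * (s + 4 choose 5))"
    by (simp only: 6)
  also have "\<dots> = 6 * (s + 5) * (s + 4) * (4 * (s + 3 choose 4))"
    by (simp add: 5)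
  also have "\<dots> = (s + 5) * (s + 4) * (s + 3) * (6 * (s + 2 choose 3))"
    by (simp add: 4)
  also have "\<dots> = s * (s + 1) * (s + 2) * (s + 3) * (s + 4) * (s + 5)"
    by (simp only: choose_3_rising) (simp only: mult_ac)
  finally show ?thesis .
qed

lemma admissible_index_0:
  assumes "admissible p k d" "prime p" "k > 0"
  shows "two_power_sum p (k * d)"
  using admissibleD[of p k 0 d] assms by (auto dest: prime_gt_1_nat)

lemma admissible_index_1:
  assumes "admissible p (s + 2) d" "\<not> p dvd s"
  shows "two_power_sum p (s * d)"
proof -
  have "s > 0"
    using assms(2) by (intro Nat.gr0I) auto
  then show ?thesis
    using admissibleD[of p s 1 d] assms by simp
qed

lemma admissible_index_2:
  assumes "admissible p (s + 4) d" "prime p" "\<not> p dvd s" "\<not> p dvd s + 1"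
  shows "two_power_sum p (s * d)"
proof -
  have "s > 0"
    using assms(3) by (intro Nat.gr0I) auto
  moreover have "\<not> p dvd s * (s + 1)"
    using assms(2-4) by (simp only: prime_dvd_mult_iff) simp
  then have "\<not> p dvd (s + 1 choose 2)"
    by (metis choose_2_rising dvd_mult)
  ultimately show ?thesis
    using admissibleD[of p s 2 d] assms(1) by simp
qed

text \<open>
  Here \<open>s (s + 1) (s + 2)\<close> contains exactly one factor 3, as does \<open>3!\<close>.
\<close>

lemma admissible_index_3:
  assumes "admissible 3 (s + 6) d" "3 dvd s" "\<not> 9 dvd s"
  shows "two_power_sum 3 (s * d)"
proof -
  obtain t where t: "s = 3 * t"
    using assms(2) ..
  have p: "prime (3 :: nat)" by simp
  have "\<not> 3 dvd t" "\<not> 3 dvd s + 1" "\<not> 3 dvd s + 2"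
    using assms(3) by (auto simp: t) presburger+
  then have "\<not> 3 dvd t * (s + 1) * (s + 2)"
    by (simp only: prime_dvd_mult_iff[OF p]) simp
  moreover have "3 * (2 * (s + 2 choose 3)) = 3 * (t * (s + 1) * (s + 2))"
    using choose_3_rising[of s] by (simp add: t)
  then have "2 * (s + 2 choose 3) = t * (s + 1) * (s + 2)"
    by (simp only: mult_cancel1) simp
  ultimately have "\<not> 3 dvd (s + 2 choose 3)"
    by (metis dvd_mult)
  moreover have "s > 0"
    using assms(3) by (intro Nat.gr0I) auto
  ultimately show ?thesis
    using admissibleD[of 3 s 3 d] assms(1) by simp
qed

text \<open>
  Of the six factors of \<open>s \<cdots> (s + 5)\<close> only \<open>s\<close> and \<open>s + 3\<close> are divisible by 3, each exactly once; this
  matches the factor 9 of \<open>6! = 720\<close>.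
\<close>

lemma admissible_index_6:
  assumes "admissible 3 (s + 12) d" "s mod 9 = 3"
  shows "two_power_sum 3 (s * d)"
proof -
  define m where "m = s div 9"
  have s: "s = 9 * m + 3"
    using assms(2) div_mult_mod_eq[of s 9] by (simp add: m_def)
  have p: "prime (3 :: nat)" by simp
  have "9 * (80 * (s + 5 choose 6)) =
      9 * ((3 * m + 1) * (s + 1) * (s + 2) * (3 * m + 2) * (s + 4) * (s + 5))"
    using choose_6_rising[of s] by (simp add: s algebra_simps)
  then have eq: "80 * (s + 5 choose 6) = (3 * m + 1) * (s + 1) * (s + 2) * (3 * m + 2) * (s + 4) * (s + 5)"
    by (simp only: mult_cancel1) simp
  have "\<not> 3 dvd 3 * m + 1" "\<not> 3 dvd s + 1" "\<not> 3 dvd s + 2" "\<not> 3 dvd 3 * m + 2" "\<not> 3 dvd s + 4" "\<not> 3 dvd s + 5"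
    unfolding s by presburger+
  then have "\<not> 3 dvd (s + 5 choose 6)"
    by (metis eq dvd_mult prime_dvd_mult_iff[OF p])
  then show ?thesis
    using admissibleD[of 3 s 6 d] assms(1) s by simp
qed

text \<open>
  For odd \<open>k\<close> the last coefficient is \<open>(i choose i) = 1\<close>, at the exponent \<open>d\<close>.
\<close>

lemma admissible_exponent_1:
  assumes "admissible p k d" "prime p" "odd k"
  shows "two_power_sum p d"
proof -
  obtain i where "k = 1 + 2 * i"
    using assms(3) by (auto elim: oddE)
  then show ?thesis
    using admissibleD[of p 1 i d] assms(1,2) by (auto dest: prime_gt_1_nat)
qed

lemma odd_prime_facts:
  fixes p :: nat
  assumes "prime p" "odd p"
  shows "p > 2" and "\<not> p dvd 2" and "\<not> p dvd 4"
proof -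
  show "p > 2"
    using assms prime_gt_1_nat[of p] by (cases "p = 2") auto
  then show "\<not> p dvd 2"
    by (auto dest: dvd_imp_le)
  then show "\<not> p dvd 4"
    using prime_dvd_mult_iff[OF assms(1), of 2 2] by simp
qed

section \<open>Odd indices\<close>

text \<open>
  The gap argument for \<open>k d\<close> and \<open>(k - 2) d\<close>, whose difference is \<open>2 d\<close>, gives \<open>(k - 2) d = 2\<close>.
\<close>

lemma odd_index_top_two_coprime:
  assumes p: "prime p" "odd p" and "odd s" and "\<not> p dvd d"
    and k: "k = s + 2" and adm: "admissible p k d"
    and nd: "\<not> p dvd k" "\<not> p dvd s"
  shows "k = 3 \<and> p = 5 \<and> d = 2"
proof -
  note p2 = odd_prime_facts[OF p]
  have "s > 0"
    using \<open>odd s\<close> by (rule odd_pos)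
  have kd: "two_power_sum p (k * d)"
    using admissible_index_0[OF adm p(1)] k by simp
  have low: "two_power_sum p (s * d)"
    using admissible_index_1 adm nd k by blast
  have ndm: "\<not> p dvd s * d" "\<not> p dvd k * d" "\<not> p dvd 2 * d"
    using nd p2 \<open>\<not> p dvd d\<close> by (simp_all add: prime_dvd_mult_iff[OF p(1)])
  have eq: "k * d = s * d + 2 * d"
    by (simp add: k algebra_simps)
  have "s * d = 2"
    using p2(1) by (intro two_power_sum_gap[OF _ low kd eq ndm]) simp
  then have "s dvd 2"
    by (metis dvd_triv_left)
  then have "s \<le> 2"
    by (rule dvd_imp_le) simp
  with \<open>odd s\<close> \<open>s > 0\<close> have "s = 1"
    by (cases "s = 2") auto
  with \<open>s * d = 2\<close> k have k3: "k = 3" "d = 2"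
    by simp_all
  have "\<not> p dvd k * d"
    using nd \<open>\<not> p dvd d\<close> by (simp add: prime_dvd_mult_iff[OF p(1)])
  then obtain j where "k * d = p ^ j + 1"
    using kd two_power_sum_coprimeE by blast
  then have "p ^ j = 5"
    using k3 by simp
  then have "p = 5"
    using prime_power_iff[of p j] by simp
  with k3 show ?thesis by simp
qed

text \<open>
  The coefficient at \<open>k - 2\<close> vanishes, but the one at \<open>k - 4\<close> does not, because \<open>k - 4\<close> and \<open>k - 3\<close> are \<open>-2\<close>
  and \<open>-1\<close> modulo \<open>p\<close>. The gap argument for \<open>k d\<close> and \<open>(k - 4) d\<close> gives \<open>(k - 4) d = 2\<close>.
\<close>

lemma odd_index_dvd_second:
  assumes p: "prime p" "odd p" and "odd s" and "\<not> p dvd d"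
    and k: "k = s + 2" and adm: "admissible p k d"
    and dvd: "p dvd s"
  shows "k = 5 \<and> p = 3 \<and> d = 2"
proof -
  note p2 = odd_prime_facts[OF p]
  have "s > 0"
    using \<open>odd s\<close> by (rule odd_pos)
  have kd: "two_power_sum p (k * d)"
    using admissible_index_0[OF adm p(1)] k by simp
  have "s \<ge> 3"
    using dvd p2(1) \<open>s > 0\<close> dvd_imp_le[of p s] by simp
  then obtain t where s: "s = t + 2" and "t > 0"
    using le_Suc_ex[of 3 s] by (auto simp: numeral_eq_Suc)
  have k4: "k = t + 4"
    using k s by simp
  have "\<not> p dvd t"
    using dvd s p2 by (metis dvd_add_right_iff)
  moreover have "\<not> p dvd t + 1"
    using dvd s p2(1) dvd_add_right_iff[of p "t + 1" 1] by auto
  moreover have "\<not> p dvd k"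
    using dvd k p2 by (metis dvd_add_right_iff)
  ultimately have nd: "\<not> p dvd t" "\<not> p dvd t + 1" "\<not> p dvd k" .
  have low: "two_power_sum p (t * d)"
    using admissible_index_2 adm nd k4 p by blast
  have ndm: "\<not> p dvd t * d" "\<not> p dvd k * d" "\<not> p dvd 4 * d"
    using nd p2 \<open>\<not> p dvd d\<close> by (simp_all add: prime_dvd_mult_iff[OF p(1)])
  have eq: "k * d = t * d + 4 * d"
    by (simp add: k4 algebra_simps)
  have "t * d = 2"
    using p2(1) by (intro two_power_sum_gap[OF _ low kd eq ndm]) simp
  then have "t dvd 2"
    by (metis dvd_triv_left)
  then have "t \<le> 2"
    by (rule dvd_imp_le) simp
  with \<open>odd s\<close> \<open>t > 0\<close> s have "t = 1"
    by (cases "t = 2") auto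
  then have "p dvd 3"
    using dvd s by (simp add: numeral_eq_Suc)
  then have "p = 3"
    using p by (simp add: primes_dvd_imp_eq)
  with \<open>t = 1\<close> \<open>t * d = 2\<close> k4 show ?thesis by simp
qed

text \<open>
  The case \<open>p = 5\<close>, \<open>d = 2\<close>: the coefficient at \<open>k - 4\<close> does not vanish, and
  \<open>2 (k - 4) = 5^\<gamma> - 3\<close> is prime to 5, so \<open>5^\<gamma> = 5^\<delta> + 4\<close>, which forces \<open>\<delta> = 0\<close>.
\<close>

lemma odd_index_dvd_char_5:
  assumes adm: "admissible 5 k 2" and "5 dvd k" and eq: "2 * k = 5 ^ \<gamma> + 5" and "\<gamma> > 0"
  shows "k = 5"
proof -
  have p: "prime (5 :: nat)" by simp
  define t where "t = k - 4"
  have "k \<ge> 5"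
    using eq \<open>5 dvd k\<close> by (intro dvd_imp_le) auto
  then have k4: "k = t + 4"
    by (simp add: t_def)
  have nd: "\<not> 5 dvd t" "\<not> 5 dvd t + 1" "\<not> 5 dvd t * 2"
    using \<open>5 dvd k\<close> unfolding k4 by presburger+
  have "two_power_sum 5 (t * 2)"
    using admissible_index_2[OF _ p nd(1,2)] adm k4 by simp
  then obtain \<delta> where \<delta>: "t * 2 = 5 ^ \<delta> + 1"
    using nd(3) by (rule two_power_sum_coprimeE)
  then have eq': "5 ^ \<gamma> = 5 ^ \<delta> + (4 :: nat)"
    using eq k4 by simp
  obtain g where g: "\<gamma> = Suc g"
    using \<open>\<gamma> > 0\<close> gr0_conv_Suc by blast
  have "\<delta> = 0"
  proof (rule ccontr)
    assume "\<delta> \<noteq> 0"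
    then obtain h where "\<delta> = Suc h"
      using not0_implies_Suc by blast
    with eq' g have "5 * 5 ^ g = 5 * 5 ^ h + (4 :: nat)"
      by simp
    then show False
      by presburger
  qed
  with \<delta> k4 show ?thesis by simp
qed

text \<open>
  For \<open>\<gamma> \<ge> 3\<close> the number \<open>k\<close> is divisible by 9, so the exponent \<open>k - 6\<close> contains exactly one factor 3 and
  its coefficient does not vanish. Then \<open>4 (k - 6) = 3^\<gamma> - 15\<close> must be a sum of two powers of 3, which
  happens only for \<open>\<gamma> = 3\<close>, that is, \<open>k = 9\<close>.
\<close>

lemma odd_index_dvd_char_3_alpha_1:
  assumes adm: "admissible 3 k 4" and eq: "4 * k = 3 ^ \<gamma> + 9"
  shows "k = 3 \<or> k = 9"
proof -
  consider "\<gamma> = 0" | "\<gamma> = 1" | "\<gamma> = 2" | "\<gamma> \<ge> 3"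
    by linarith
  then show ?thesis
  proof cases
    case 1
    then have "4 * k = 10" using eq by simp
    then show ?thesis by presburger
  next
    case 2
    then show ?thesis using eq by simp
  next
    case 3
    then have "4 * k = 18" using eq by simp
    then show ?thesis by presburger
  next
    case 4
    \<comment> \<open>For the divisibility arguments below only \<open>x > 0\<close> matters.\<close>
    define x :: nat where "x = 3 ^ (\<gamma> - 3)"
    have "(3 :: nat) ^ \<gamma> = 3 ^ (3 + (\<gamma> - 3))"
      using 4 by simp
    also have "\<dots> = 27 * x"
      unfolding x_def by (subst power_add) simp
    finally have eq': "4 * k = 27 * x + 9"
      using eq by simp
    have "x > 0"
      by (simp add: x_def)
    have "9 dvd k"
      using eq' by presburger
    have "k \<ge> 9"
      using eq' \<open>x > 0\<close> by linarith
    define t where "t = k - 6"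
    have k6: "k = t + 6"
      using \<open>k \<ge> 9\<close> by (simp add: t_def)
    have "3 dvd t" "\<not> 9 dvd t"
      using \<open>9 dvd k\<close> unfolding k6 by presburger+
    then have "two_power_sum 3 (t * 4)"
      using admissible_index_3 adm k6 by blast
    moreover have "t * 4 = 3 * (9 * x - 5)"
      using eq' k6 by simp
    ultimately have "two_power_sum 3 (9 * x - 5)"
      using two_power_sum_mult_iff[of 3 "9 * x - 5"] by simp
    moreover have "\<not> 3 dvd 9 * x - 5"
      using \<open>x > 0\<close> by presburger
    ultimately obtain \<delta> where "9 * x - 5 = 3 ^ \<delta> + 1"
      by (rule two_power_sum_coprimeE)
    then have eq3: "9 * x = 3 ^ \<delta> + 6"
      by linarith
    consider "\<delta> = 0" | "\<delta> = 1" | h where "\<delta> = Suc (Suc h)"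
      by (cases \<delta>; cases "\<delta> - 1") auto
    then show ?thesis
    proof cases
      case 1
      with eq3 have "9 * x = 7" by simp
      then show ?thesis by presburger
    next
      case 2
      with eq3 eq' show ?thesis by simp
    next
      case 3
      with eq3 have "9 * x = 9 * 3 ^ h + 6" by simp
      then show ?thesis by presburger
    qed
  qed
qed

text \<open>
  Here \<open>(s + 2) d = 3^(g+1) + 2 \<cdot> 3^(a+2) + 3\<close> is three times a number \<open>M\<close> prime to 3, so \<open>M - 1\<close> is a
  power of 3. If \<open>s > 1\<close>, then \<open>g > a + 1\<close>, and \<open>M - 1 = 3^(a+1) (3^(g-a-1) + 2)\<close> has a divisor that is
  larger than 1 and prime to 3.
\<close>

lemma odd_index_dvd_char_3_alpha_ge_2:
  assumes kd: "two_power_sum 3 ((s + 2) * d)" and d: "d = 3 ^ Suc (Suc a) + 1"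
    and sd: "s * d = 3 ^ Suc g + 1" and "s > 0"
  shows "s = 1"
proof -
  have "s * d \<ge> d"
    using \<open>s > 0\<close> by simp
  then have "(3 :: nat) ^ Suc (Suc a) \<le> 3 ^ Suc g"
    using sd d by simp
  then have "Suc a \<le> g"
    by (subst (asm) power_increasing_iff) simp_all
  show ?thesis
  proof (cases "g = Suc a")
    case True
    then have "s * d = 1 * d" using sd d by simp
    then show ?thesis using d by (simp only: mult_cancel2) simp
  next
    case False
    define h where "h = g - Suc (Suc a)"
    have h: "g = Suc (Suc (a + h))"
      using False \<open>Suc a \<le> g\<close> by (simp add: h_def)
    define M :: nat where "M = 3 ^ g + 1 + 2 * 3 ^ Suc a"
    have "(s + 2) * d = 3 * M"
      using sd d by (simp add: M_def add_mult_distrib)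
    then have "two_power_sum 3 M"
      using kd two_power_sum_mult_iff[of 3 M] by simp
    moreover have "M = 3 * (3 ^ Suc (a + h) + 2 * 3 ^ a) + 1"
      by (simp add: M_def h)
    then have "\<not> 3 dvd M"
      by presburger
    ultimately obtain \<beta> where "M = 3 ^ \<beta> + 1"
      by (rule two_power_sum_coprimeE)
    then have "3 ^ \<beta> = 3 ^ Suc a * (3 * 3 ^ h + 2 :: nat)"
      by (simp add: M_def h power_add algebra_simps)
    then have "3 * 3 ^ h + 2 dvd (3 :: nat) ^ \<beta>"
      by (metis dvd_triv_right)
    then obtain c where c: "3 * 3 ^ h + 2 = (3 :: nat) ^ c"
      using divides_primepow_nat[of 3 "3 * 3 ^ h + 2" \<beta>] by auto
    show ?thesis
    proof (cases c)
      case 0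
      with c show ?thesis by simp
    next
      case (Suc c')
      with c have "3 * 3 ^ h + 2 = (3 :: nat) * 3 ^ c'" by simp
      then show ?thesis by presburger
    qed
  qed
qed

text \<open>
  When \<open>p\<close> divides \<open>k\<close>, it does not divide \<open>k - 2\<close>, so \<open>(k - 2) d = p^\<gamma> + 1\<close> and
  \<open>k d = p^\<gamma> + 2 p^\<alpha> + 3\<close>. Reducing modulo \<open>p\<close> yields \<open>p = 3\<close> if \<open>\<alpha>\<close> and \<open>\<gamma>\<close> are positive and
  \<open>p = 5\<close> if only \<open>\<gamma>\<close> is; for \<open>\<gamma> = 0\<close> the equation \<open>(k - 2) d = 2\<close> leaves \<open>k = 3\<close>.
\<close>

lemma odd_index_dvd:
  assumes p: "prime p" "odd p" and "odd s" and "\<not> p dvd d"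
    and k: "k = s + 2" and adm: "admissible p k d" and d: "d = p ^ \<alpha> + 1"
    and dvd: "p dvd k"
  shows "k = 3 \<and> p = 3 \<or> k = 5 \<and> p = 5 \<and> d = 2 \<or> k = 9 \<and> p = 3 \<and> d = 4"
proof -
  note p2 = odd_prime_facts[OF p]
  have "s > 0"
    using \<open>odd s\<close> by (rule odd_pos)
  have kd: "two_power_sum p (k * d)"
    using admissible_index_0[OF adm p(1)] k by simp
  have nds: "\<not> p dvd s"
    using dvd k p2(2) by (metis dvd_add_right_iff)
  have "\<not> p dvd s * d"
    using nds \<open>\<not> p dvd d\<close> by (simp add: prime_dvd_mult_iff[OF p(1)])
  moreover have "two_power_sum p (s * d)"
    using admissible_index_1 adm nds k by blast
  ultimately obtain \<gamma> where \<gamma>: "s * d = p ^ \<gamma> + 1"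
    using two_power_sum_coprimeE by blast
  have kd_eq: "k * d = p ^ \<gamma> + 1 + 2 * d"
    using \<gamma> by (simp add: k algebra_simps)
  have "p dvd k * d"
    using dvd by simp
  consider "\<gamma> = 0" | "\<gamma> > 0" "\<alpha> = 0" | "\<gamma> > 0" "\<alpha> > 0"
    by blast
  then show ?thesis
  proof cases
    case 1
    then have "s * d = 2" "d \<ge> 2"
      using \<gamma> d p2(1) by simp_all
    moreover have "s * d \<ge> s * 2"
      using \<open>d \<ge> 2\<close> by simp
    ultimately have "s = 1"
      using \<open>s > 0\<close> by simp
    with \<open>s * d = 2\<close> have "d = 2"
      by simp
    have "p dvd 3"
      using dvd k \<open>s = 1\<close> by (simp add: numeral_eq_Suc)
    then have "p = 3"
      using p by (simp add: primes_dvd_imp_eq)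
    then show ?thesis
      using k \<open>s = 1\<close> by simp
  next
    case 2
    then have "d = 2"
      using d by simp
    have "p dvd p ^ \<gamma>"
      using 2 by simp
    moreover have eq: "k * d = p ^ \<gamma> + 5"
      using kd_eq \<open>d = 2\<close> by simp
    ultimately have "p dvd 5"
      using \<open>p dvd k * d\<close> by (simp only: dvd_add_right_iff)
    then have "p = 5"
      using p by (simp add: primes_dvd_imp_eq)
    then have "k = 5"
      using odd_index_dvd_char_5[of k \<gamma>] adm dvd eq \<open>d = 2\<close> \<open>\<gamma> > 0\<close> by (simp add: mult.commute)
    with \<open>p = 5\<close> \<open>d = 2\<close> show ?thesis by simp
  next
    case 3
    have "p dvd p ^ \<gamma> + 2 * p ^ \<alpha>"
      using 3 by simp
    moreover have "k * d = p ^ \<gamma> + 2 * p ^ \<alpha> + 3"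
      using kd_eq d by simp
    ultimately have "p dvd 3"
      using \<open>p dvd k * d\<close> by (simp only: dvd_add_right_iff)
    then have "p = 3"
      using p by (simp add: primes_dvd_imp_eq)
    obtain g where g: "\<gamma> = Suc g"
      using 3 gr0_conv_Suc by blast
    consider "\<alpha> = 1" | a where "\<alpha> = Suc (Suc a)"
      using \<open>\<alpha> > 0\<close> by (cases \<alpha>; cases "\<alpha> - 1") auto
    then show ?thesis
    proof cases
      case 1
      then have "d = 4"
        using d \<open>p = 3\<close> by simp
      then show ?thesis
        using odd_index_dvd_char_3_alpha_1[of k \<gamma>] adm kd_eq \<open>p = 3\<close> by auto
    next
      case (2 a)
      then have "s = 1"
        using odd_index_dvd_char_3_alpha_ge_2[of s d a g] kd k d \<gamma> g \<open>p = 3\<close> \<open>s > 0\<close> by simp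
      then show ?thesis
        using k \<open>p = 3\<close> by simp
    qed
  qed
qed

lemma admissible_odd_classification:
  assumes p: "prime p" "odd p" and "odd k" and "\<not> p dvd d" and adm: "admissible p k d"
  shows "(k = 1 \<and> (\<exists>\<alpha>. d = p ^ \<alpha> + 1))
    \<or> (k = 3 \<and> (p = 3 \<and> (\<exists>\<alpha>. d = p ^ \<alpha> + 1) \<or> p = 5 \<and> d = 2))
    \<or> (k = 5 \<and> (p = 3 \<or> p = 5) \<and> d = 2)
    \<or> (k = 9 \<and> p = 3 \<and> d = 4)"
proof -
  obtain \<alpha> where d: "d = p ^ \<alpha> + 1"
    using two_power_sum_coprimeE admissible_exponent_1[OF adm p(1) \<open>odd k\<close>] \<open>\<not> p dvd d\<close> by blast
  show ?thesis
  proof (cases "k = 1")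
    case True
    with d show ?thesis by auto
  next
    case False
    define s where "s = k - 2"
    have s: "k = s + 2" "odd s"
      using False \<open>odd k\<close> by (cases "k = 0"; cases "k = 2"; simp add: s_def)+
    consider "\<not> p dvd k" "\<not> p dvd s" | "p dvd s" | "p dvd k"
      by blast
    then show ?thesis
      by cases (use odd_index_top_two_coprime[OF p s(2) \<open>\<not> p dvd d\<close> s(1) adm]
          odd_index_dvd_second[OF p s(2) \<open>\<not> p dvd d\<close> s(1) adm]
          odd_index_dvd[OF p s(2) \<open>\<not> p dvd d\<close> s(1) adm d] d in auto)
  qed
qed

section \<open>Even indices\<close>

text \<open>
  For even \<open>k = 2 l\<close> all exponents are even multiples of \<open>d\<close>, hence multiples of \<open>2 d\<close>. From here on they
  are measured in units of \<open>2 d\<close>, so that \<open>l\<close>, \<open>l - 1\<close>, \<open>l - 2\<close> replace \<open>k\<close>, \<open>k - 2\<close>, \<open>k - 4\<close>.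
\<close>

lemma admissible_even_index_0:
  assumes "admissible p (2 * l) d" "prime p" "l > 0"
  shows "two_power_sum p (l * (2 * d))"
  using admissible_index_0[of p "2 * l" d] assms by (simp add: mult_ac)

lemma admissible_even_index_1:
  assumes "admissible p (2 * (t + 1)) d" "prime p" "odd p" "\<not> p dvd t"
  shows "two_power_sum p (t * (2 * d))"
  using admissible_index_1[of p "2 * t" d] assms odd_prime_facts[of p]
  by (simp add: mult_ac prime_dvd_mult_iff)

lemma admissible_even_index_2:
  assumes "admissible p (2 * (t + 2)) d" "prime p" "odd p" "\<not> p dvd t" "\<not> p dvd 2 * t + 1"
  shows "two_power_sum p (t * (2 * d))"
proof -
  have "admissible p (2 * t + 4) d"
  proof -
    have "2 * (t + 2) = 2 * t + 4" by simp
    with assms(1) show ?thesis by (simp only:)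
  qed
  moreover have "\<not> p dvd 2 * t"
    using assms odd_prime_facts[of p] by (simp add: prime_dvd_mult_iff)
  ultimately have "two_power_sum p (2 * t * d)"
    using admissible_index_2 assms(2,5) by blast
  moreover have "2 * t * d = t * (2 * d)"
    by simp
  ultimately show ?thesis
    by (simp only:)
qed

lemma mult_double_eq_2:
  fixes t d :: nat
  assumes "t * (2 * d) = 2"
  shows "t = 1" "d = 1"
  using assms by simp_all

text \<open>
  The gap argument for the multiples \<open>t + 1\<close> and \<open>t\<close> of \<open>2 d\<close> gives \<open>2 t d = 2\<close>.
\<close>

lemma even_index_top_two_coprime:
  assumes p: "prime p" "odd p" and "\<not> p dvd d"
    and adm: "admissible p (2 * (t + 1)) d" and nd: "\<not> p dvd t" "\<not> p dvd t + 1"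
  shows "t = 1 \<and> p = 3 \<and> d = 1"
proof -
  note p2 = odd_prime_facts[OF p]
  have top: "two_power_sum p ((t + 1) * (2 * d))"
    using admissible_even_index_0[OF adm p(1)] by simp
  have ndm: "\<not> p dvd (t + 1) * (2 * d)" "\<not> p dvd t * (2 * d)" "\<not> p dvd 2 * d"
    using nd \<open>\<not> p dvd d\<close> p2 by (simp_all only: prime_dvd_mult_iff[OF p(1)]) simp_all
  have eq: "(t + 1) * (2 * d) = t * (2 * d) + 2 * d"
    by simp
  have "t * (2 * d) = 2"
    using p2(1) by (intro two_power_sum_gap[OF _ admissible_even_index_1[OF adm p nd(1)] top eq ndm(2,1,3)]) simp
  then have td: "t = 1" "d = 1"
    by (rule mult_double_eq_2)+
  obtain j where "(t + 1) * (2 * d) = p ^ j + 1"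
    using top ndm(1) by (rule two_power_sum_coprimeE)
  then have "p ^ j = 3"
    using td by simp
  then have "p = 3"
    using prime_power_iff[of p j] by simp
  with td show ?thesis by simp
qed

text \<open>
  With \<open>u = t - 1\<close> the coefficient at \<open>u\<close> is \<open>u (2 u + 1)\<close>, which is 1 modulo \<open>p\<close> if \<open>p\<close> divides \<open>t\<close>.
  The gap argument for the multiples \<open>u + 2\<close> and \<open>u\<close> of \<open>2 d\<close> then gives \<open>t = 2\<close>, against \<open>p\<close> being odd.
\<close>

lemma even_index_not_dvd_second:
  assumes p: "prime p" "odd p" and "\<not> p dvd d"
    and adm: "admissible p (2 * (t + 1)) d" and "t > 0"
  shows "\<not> p dvd t"
proof
  assume "p dvd t"
  note p2 = odd_prime_facts[OF p]
  define u where "u = t - 1"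
  have t: "t = u + 1"
    using \<open>t > 0\<close> by (simp add: u_def)
  have "\<not> p dvd 1"
    using p2(1) by simp
  moreover have "u + 2 = t + 1" "2 * t = (2 * u + 1) + 1"
    using t by simp_all
  moreover have "p dvd 2 * t"
    using \<open>p dvd t\<close> by (rule dvd_mult)
  ultimately have nd: "\<not> p dvd u" "\<not> p dvd u + 2" "\<not> p dvd 2 * u + 1"
    using \<open>p dvd t\<close> t by (metis dvd_add_right_iff)+
  have adm': "admissible p (2 * (u + 2)) d"
    using adm by (simp add: t)
  have top: "two_power_sum p ((u + 2) * (2 * d))"
    using admissible_even_index_0[OF adm' p(1)] by simp
  have ndm: "\<not> p dvd (u + 2) * (2 * d)" "\<not> p dvd u * (2 * d)" "\<not> p dvd 4 * d"
    using nd \<open>\<not> p dvd d\<close> p2 by (simp_all only: prime_dvd_mult_iff[OF p(1)]) simp_all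
  have eq: "(u + 2) * (2 * d) = u * (2 * d) + 4 * d"
    by simp
  have "u * (2 * d) = 2"
    using p2(1) by (intro two_power_sum_gap[OF _ admissible_even_index_2[OF adm' p nd(1,3)] top eq ndm(2,1,3)]) simp
  then have "u = 1"
    by (rule mult_double_eq_2)
  then show False
    using p2(2) \<open>p dvd t\<close> t by (simp add: numeral_2_eq_2)
qed

text \<open>
  If \<open>p > 3\<close> divides \<open>l\<close>, the coefficients at \<open>l - 1\<close> and \<open>l - 2\<close> are prime to \<open>p\<close> (they are \<open>-2\<close> and 6 modulo
  \<open>p\<close>), and the gap argument for these two gives \<open>l = 3\<close>.
\<close>

lemma even_index_dvd_imp_char_3:
  assumes p: "prime p" "odd p" and "\<not> p dvd d"
    and adm: "admissible p (2 * l) d" and "p dvd l" and "l > 0"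
  shows "p = 3"
proof (rule ccontr)
  assume "p \<noteq> 3"
  then have p3: "\<not> p dvd 3"
    using primes_dvd_imp_eq[OF p(1), of 3] by auto
  note p2 = odd_prime_facts[OF p]
  have "l \<ge> 3"
    using \<open>p dvd l\<close> \<open>l > 0\<close> p2(1) dvd_imp_le[of p l] by simp
  define u where "u = l - 2"
  have l: "l = u + 2"
    using \<open>l \<ge> 3\<close> by (simp add: u_def)
  have "\<not> p dvd u"
    using \<open>p dvd l\<close> p2(2) l by (metis dvd_add_right_iff)
  have "\<not> p dvd u + 1"
    using \<open>p dvd l\<close> p2(1) l dvd_add_right_iff[of p "u + 1" 1] by auto
  have "2 * l = (2 * u + 1) + 3"
    using l by simp
  moreover have "p dvd 2 * l"
    using \<open>p dvd l\<close> by (rule dvd_mult)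
  ultimately have "\<not> p dvd 2 * u + 1"
    using p3 by (metis dvd_add_right_iff)
  note nd = \<open>\<not> p dvd u\<close> \<open>\<not> p dvd u + 1\<close> \<open>\<not> p dvd 2 * u + 1\<close>
  have adm': "admissible p (2 * (u + 2)) d" "admissible p (2 * ((u + 1) + 1)) d"
    using adm by (simp_all add: l)
  have ndm: "\<not> p dvd (u + 1) * (2 * d)" "\<not> p dvd u * (2 * d)" "\<not> p dvd 2 * d"
    using nd \<open>\<not> p dvd d\<close> p2 by (simp_all only: prime_dvd_mult_iff[OF p(1)]) simp_all
  have eq: "(u + 1) * (2 * d) = u * (2 * d) + 2 * d"
    by simp
  have "u * (2 * d) = 2"
    using p2(1) by (intro two_power_sum_gap[OF _ admissible_even_index_2[OF adm'(1) p nd(1,3)]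
        admissible_even_index_1[OF adm'(2) p nd(2)] eq ndm(2,1,3)]) simp
  then have "u = 1"
    by (rule mult_double_eq_2)
  then show False
    using p3 \<open>p dvd l\<close> l by (simp add: numeral_3_eq_3)
qed

text \<open>
  In units of \<open>2 d\<close> the top exponents of \<open>k = 6 (b + 1)\<close> are \<open>3 b + 3\<close>, \<open>3 b + 2\<close>, \<open>3 b + 1\<close>, \<open>3 b\<close>. The second
  and the fourth have nonvanishing coefficients, so \<open>(3 b + 2) \<cdot> 2 d = 3^\<gamma> + 1\<close> and, after division by 3,
  \<open>b \<cdot> 2 d = 3^\<delta> + 1\<close>. For \<open>b \<ge> 2\<close> the ratio of the left-hand sides lies above 3 and is at most 4,
  so \<open>3^\<gamma>\<close> would lie strictly between \<open>3^(\<delta>+1)\<close> and \<open>3^(\<delta>+2)\<close>. For \<open>b = 1\<close> the two equations give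
  \<open>3^\<gamma> = 5 \<cdot> 3^\<delta> + 4\<close>, so that \<open>\<delta> = 0\<close> by reduction modulo 3.
\<close>

lemma multiple_of_6_not_dvd:
  assumes adm: "admissible 3 (6 * (b + 1)) d" and "\<not> 3 dvd d" and "\<not> 3 dvd b"
  shows "b = 1 \<and> d = 1"
proof -
  have p: "prime (3 :: nat)" by simp
  have "\<not> 9 dvd 6 * b" "3 dvd 6 * b"
    using \<open>\<not> 3 dvd b\<close> by presburger+
  then have "two_power_sum 3 (6 * b * d)"
    using admissible_index_3[of "6 * b" d] adm by (simp add: add.commute)
  then have "two_power_sum 3 (b * (2 * d))"
    using two_power_sum_mult_iff[of 3 "b * (2 * d)"] by (simp add: mult_ac)
  moreover have "\<not> 3 dvd b * (2 * d)"
    using \<open>\<not> 3 dvd b\<close> \<open>\<not> 3 dvd d\<close> by (simp add: prime_dvd_mult_iff[OF p])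
  ultimately obtain \<delta> where \<delta>: "b * (2 * d) = 3 ^ \<delta> + 1"
    by (rule two_power_sum_coprimeE)
  have nd: "\<not> 3 dvd 3 * b + 2"
    by presburger
  have "two_power_sum 3 ((3 * b + 2) * (2 * d))"
  proof (rule admissible_even_index_1)
    have "2 * (3 * b + 2 + 1) = 6 * (b + 1)" by simp
    with adm show "admissible 3 (2 * (3 * b + 2 + 1)) d" by (simp only:)
  qed (use nd in simp_all)
  moreover have "\<not> 3 dvd (3 * b + 2) * (2 * d)"
    using nd \<open>\<not> 3 dvd d\<close> by (simp only: prime_dvd_mult_iff[OF p]) simp
  ultimately obtain \<gamma> where \<gamma>: "(3 * b + 2) * (2 * d) = 3 ^ \<gamma> + 1"
    by (rule two_power_sum_coprimeE)
  have \<gamma>': "3 ^ \<gamma> = 3 * 3 ^ \<delta> + 2 + 2 * (2 * d)"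
    using \<gamma> \<delta> by (simp add: algebra_simps)
  have "d > 0"
    using \<open>\<not> 3 dvd d\<close> by (intro Nat.gr0I) auto
  have "b = 1"
  proof (rule ccontr)
    assume "b \<noteq> 1"
    then have "b \<ge> 2"
      using \<open>\<not> 3 dvd b\<close> by (cases "b = 0") auto
    then have "2 * (2 * d) \<le> b * (2 * d)"
      by (rule mult_right_mono) simp
    then have "3 ^ \<gamma> \<le> 4 * 3 ^ \<delta> + (3 :: nat)"
      using \<gamma>' \<delta> by linarith
    moreover have "(3 :: nat) ^ \<delta> > 0" "(3 :: nat) ^ (\<delta> + 2) = 9 * 3 ^ \<delta>"
      by (simp_all add: power_add)
    ultimately have "(3 :: nat) ^ \<gamma> < 3 ^ (\<delta> + 2)"
      by linarith
    moreover have "(3 :: nat) ^ (\<delta> + 1) < 3 ^ \<gamma>"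
      using \<gamma>' by simp
    ultimately have "\<gamma> < \<delta> + 2" "\<delta> + 1 < \<gamma>"
      by (simp_all only: power_strict_increasing_iff)
    then show False by simp
  qed
  then have D: "2 * d = 3 ^ \<delta> + 1"
    using \<delta> by simp
  then have eq: "3 ^ \<gamma> = 5 * 3 ^ \<delta> + (4 :: nat)"
    using \<gamma>' by simp
  have "\<delta> = 0"
  proof (rule ccontr)
    assume "\<delta> \<noteq> 0"
    then obtain h where h: "\<delta> = Suc h"
      using not0_implies_Suc by blast
    show False
    proof (cases \<gamma>)
      case 0
      with eq show False by simp
    next
      case (Suc g)
      with eq h have "3 * 3 ^ g = 5 * (3 * 3 ^ h) + (4 :: nat)"
        by simp
      then show False by presburger
    qed
  qed
  with D \<open>b = 1\<close> show ?thesis by simp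
qed

text \<open>
  If 3 divides \<open>b\<close>, the coefficient at \<open>3 b\<close> vanishes, and the top exponent takes its place:
  \<open>(b + 1) \<cdot> 2 d = 3^\<beta> + 1\<close> and \<open>(3 b + 2) \<cdot> 2 d = 3^\<gamma> + 1\<close>. Comparing sizes gives \<open>\<gamma> = \<beta> + 1\<close>, which means
  \<open>d = 1\<close>. For positive \<open>b\<close> the exponent \<open>k - 12 = 6 (b - 1)\<close> has a nonvanishing coefficient, and
  \<open>6 (b - 1) = 3^(\<beta>+1) - 9\<close> is a sum of two powers of 3 only if \<open>b = 4\<close>, which 3 does not divide.
\<close>

lemma multiple_of_6_dvd:
  assumes adm: "admissible 3 (6 * (b + 1)) d" and "\<not> 3 dvd d" and "3 dvd b"
  shows "b = 0 \<and> d = 1"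
proof -
  have p: "prime (3 :: nat)" by simp
  have "d > 0"
    using \<open>\<not> 3 dvd d\<close> by (intro Nat.gr0I) auto
  have "two_power_sum 3 (6 * (b + 1) * d)"
    using admissible_index_0[OF adm p] by simp
  then have "two_power_sum 3 ((b + 1) * (2 * d))"
    using two_power_sum_mult_iff[of 3 "(b + 1) * (2 * d)"] by (simp add: algebra_simps)
  moreover have "\<not> 3 dvd b + 1"
    using \<open>3 dvd b\<close> by presburger
  then have "\<not> 3 dvd (b + 1) * (2 * d)"
    using \<open>\<not> 3 dvd d\<close> by (simp only: prime_dvd_mult_iff[OF p]) simp
  ultimately obtain \<beta> where \<beta>: "(b + 1) * (2 * d) = 3 ^ \<beta> + 1"
    by (rule two_power_sum_coprimeE)
  have nd: "\<not> 3 dvd 3 * b + 2"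
    by presburger
  have "two_power_sum 3 ((3 * b + 2) * (2 * d))"
  proof (rule admissible_even_index_1)
    have "2 * (3 * b + 2 + 1) = 6 * (b + 1)" by simp
    with adm show "admissible 3 (2 * (3 * b + 2 + 1)) d" by (simp only:)
  qed (use nd in simp_all)
  moreover have "\<not> 3 dvd (3 * b + 2) * (2 * d)"
    using nd \<open>\<not> 3 dvd d\<close> by (simp only: prime_dvd_mult_iff[OF p]) simp
  ultimately obtain \<gamma> where \<gamma>: "(3 * b + 2) * (2 * d) = 3 ^ \<gamma> + 1"
    by (rule two_power_sum_coprimeE)
  have \<gamma>': "3 ^ \<gamma> + 2 * d = 3 * 3 ^ \<beta> + 2"
    using \<gamma> \<beta> by (simp add: algebra_simps)
  have "2 * d \<le> 3 ^ \<beta> + 1"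
    using \<beta> by simp
  moreover have "(3 :: nat) ^ \<beta> > 0" "(3 :: nat) ^ (\<beta> + 2) = 9 * 3 ^ \<beta>"
    by (simp_all add: power_add)
  ultimately have "3 ^ \<beta> < (3 :: nat) ^ \<gamma>" "(3 :: nat) ^ \<gamma> < 3 ^ (\<beta> + 2)"
    using \<gamma>' \<open>d > 0\<close> by linarith+
  then have "\<beta> < \<gamma>" "\<gamma> < \<beta> + 2"
    by (simp_all only: power_strict_increasing_iff)
  then have "\<gamma> = \<beta> + 1" by simp
  then have "d = 1"
    using \<gamma>' by simp
  have "b = 0"
  proof (rule ccontr)
    assume "b \<noteq> 0"
    obtain m where m: "b = 3 * m"
      using \<open>3 dvd b\<close> ..
    define s where "s = 6 * b - 6"
    have s: "6 * (b + 1) = s + 12"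
      using \<open>b \<noteq> 0\<close> by (simp add: s_def)
    have "s mod 9 = 3"
    proof -
      obtain m' where "m = Suc m'"
        using \<open>b \<noteq> 0\<close> m not0_implies_Suc by (cases m) auto
      then have "s = 3 + 9 * (2 * m' + 1)"
        by (simp add: s_def m)
      then show ?thesis
        by (simp only: mod_mult_self2) simp
    qed
    then have tps: "two_power_sum 3 s"
      using admissible_index_6[OF adm[unfolded s]] \<open>d = 1\<close> by simp
    have b\<beta>: "2 * b + 1 = 3 ^ \<beta>"
      using \<beta> \<open>d = 1\<close> by simp
    consider "\<beta> = 0" | "\<beta> = 1" | h where "\<beta> = Suc (Suc h)"
      by (cases \<beta>; cases "\<beta> - 1") auto
    then show False
    proof cases
      case 1
      with b\<beta> \<open>b \<noteq> 0\<close> show False by simp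
    next
      case 2
      with b\<beta> \<open>3 dvd b\<close> show False by simp
    next
      case (3 h)
      define x :: nat where "x = 3 ^ h"
      have "x > 0"
        by (simp add: x_def)
      have bx: "2 * b + 1 = 9 * x"
        using b\<beta> 3 by (simp add: x_def)
      then have "s = 3 * (3 * (3 * x - 1))"
        using s by simp
      then have "two_power_sum 3 (3 * x - 1)"
        using tps two_power_sum_mult_iff[of 3 "3 * (3 * x - 1)"]
          two_power_sum_mult_iff[of 3 "3 * x - 1"] by simp
      moreover have "\<not> 3 dvd 3 * x - 1"
        using \<open>x > 0\<close> by presburger
      ultimately obtain \<delta> where "3 * x - 1 = 3 ^ \<delta> + 1"
        by (rule two_power_sum_coprimeE)
      then have eq: "3 * x = 3 ^ \<delta> + 2"
        by linarith
      show False
      proof (cases \<delta>)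
        case 0
        with eq bx m show False by simp presburger
      next
        case (Suc e)
        with eq have "3 * x = 3 * 3 ^ e + 2" by simp
        then show False by presburger
      qed
    qed
  qed
  with \<open>d = 1\<close> show ?thesis by simp
qed

lemma admissible_even_classification:
  assumes p: "prime p" "odd p" and "even k" and "k > 0" and "\<not> p dvd d" and adm: "admissible p k d"
  shows "(k = 2 \<and> (\<exists>\<alpha>. 2 * d = p ^ \<alpha> + 1)) \<or> (k \<in> {4, 6, 12} \<and> p = 3 \<and> d = 1)"
proof -
  obtain l where k: "k = 2 * l"
    using \<open>even k\<close> by (auto elim: evenE)
  define t where "t = l - 1"
  have l: "l = t + 1"
    using \<open>k > 0\<close> k by (simp add: t_def)
  have adm': "admissible p (2 * l) d"
    using adm k by simp
  show ?thesis
  proof (cases "t = 0")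
    case True
    then have "two_power_sum p (2 * d)"
      using admissible_even_index_0[OF adm' p(1)] l by simp
    moreover have "\<not> p dvd 2 * d"
      using \<open>\<not> p dvd d\<close> odd_prime_facts[OF p] by (simp add: prime_dvd_mult_iff[OF p(1)])
    ultimately obtain \<alpha> where "2 * d = p ^ \<alpha> + 1"
      by (rule two_power_sum_coprimeE)
    with True show ?thesis
      using k l by auto
  next
    case False
    show ?thesis
    proof (cases "p dvd l")
      case True
      then have "p = 3"
        using even_index_dvd_imp_char_3[OF p \<open>\<not> p dvd d\<close> adm'] l by simp
      obtain c where c: "l = 3 * c"
        using True \<open>p = 3\<close> by auto
      \<comment> \<open>The shift \<open>b = c - 1\<close> turns the exponent \<open>k - 6\<close> into \<open>6 b\<close>.\<close>
      define b where "b = c - 1"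
      have b: "k = 6 * (b + 1)"
        using k l c by (cases c) (simp_all add: b_def)
      have "admissible 3 (6 * (b + 1)) d" "\<not> 3 dvd d"
        using adm \<open>\<not> p dvd d\<close> \<open>p = 3\<close> b by simp_all
      then have "b \<le> 1 \<and> d = 1"
        using multiple_of_6_not_dvd[of b d] multiple_of_6_dvd[of b d] by (cases "3 dvd b") auto
      then show ?thesis
        using b \<open>p = 3\<close> by (cases "b = 0") auto
    next
      case ndl: False
      have "t = 1 \<and> p = 3 \<and> d = 1"
        using even_index_top_two_coprime[OF p \<open>\<not> p dvd d\<close>, of t] adm' l False ndl
          even_index_not_dvd_second[OF p \<open>\<not> p dvd d\<close>, of t] by simp
      then show ?thesis
        using k l by simp
    qed
  qed
qed

section \<open>The admissible pairs and the classification\<close>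

text \<open>
  The finite form of admissibility, with the index \<open>i\<close> running over the monomials of positive degree;
  for numerals \<open>k\<close> it is decided by simplification.
\<close>

lemma admissible_iff_indices:
  "admissible p k d \<longleftrightarrow>
    (\<forall>i \<in> {..<(k + 1) div 2}. \<not> p dvd (k - 1 - i choose i) \<longrightarrow> two_power_sum p ((k - 2 * i) * d))"
proof (intro iffI ballI impI)
  fix i assume adm: "admissible p k d" and i: "i \<in> {..<(k + 1) div 2}"
    and nd: "\<not> p dvd (k - 1 - i choose i)"
  have "k = (k - 2 * i) + 2 * i" "k - 2 * i > 0" "k - 2 * i + i - 1 = k - 1 - i"
    using i by auto
  then show "two_power_sum p ((k - 2 * i) * d)"
    using admissibleD[of p "k - 2 * i" i d] adm nd by simp
next
  assume *: "\<forall>i \<in> {..<(k + 1) div 2}.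
    \<not> p dvd (k - 1 - i choose i) \<longrightarrow> two_power_sum p ((k - 2 * i) * d)"
  show "admissible p k d"
    unfolding admissible_def
  proof (intro allI impI)
    fix s i assume si: "s > 0" "k = s + 2 * i" and nd: "\<not> p dvd (s + i - 1 choose i)"
    have "i \<in> {..<(k + 1) div 2}" "k - 1 - i = s + i - 1" "k - 2 * i = s"
      using si by auto
    then show "two_power_sum p (s * d)"
      using * nd by auto
  qed
qed

lemma small_binomials:
  "9 choose 2 = (36 :: nat)" "8 choose 3 = (56 :: nat)" "7 choose 4 = (35 :: nat)" "6 choose 5 = (6 :: nat)"
  "3 choose 2 = (3 :: nat)" "6 choose 2 = (15 :: nat)" "5 choose 3 = (10 :: nat)"
  by (simp_all add: numeral_eq_Suc)

lemma two_power_sum_small: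
  "two_power_sum 3 2" "two_power_sum 3 4" "two_power_sum 3 6" "two_power_sum 3 10"
  "two_power_sum 3 12" "two_power_sum 3 28" "two_power_sum 3 36"
  "two_power_sum 5 2" "two_power_sum 5 6" "two_power_sum 5 10"
  using two_power_sum_powers[of 3 0 0] two_power_sum_powers[of 3 0 1] two_power_sum_powers[of 3 1 1]
    two_power_sum_powers[of 3 0 2] two_power_sum_powers[of 3 1 2] two_power_sum_powers[of 3 0 3]
    two_power_sum_powers[of 3 2 3]
    two_power_sum_powers[of 5 0 0] two_power_sum_powers[of 5 0 1] two_power_sum_powers[of 5 1 1]
  by (simp_all add: numeral_2_eq_2)

lemma admissible_small:
  "admissible 3 4 1" "admissible 3 6 1" "admissible 3 12 1" "admissible 3 5 2" "admissible 3 9 4"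
  "admissible 5 3 2" "admissible 5 5 2"
  by (simp_all add: admissible_iff_indices small_binomials two_power_sum_small lessThan_nat_numeral lessThan_Suc)

lemma admissible_k_1:
  assumes "two_power_sum p d"
  shows "admissible p 1 d"
  using assms by (simp add: admissible_iff_indices)

lemma admissible_k_2:
  assumes "two_power_sum p (2 * d)"
  shows "admissible p 2 d"
  using assms by (simp add: admissible_iff_indices)

text \<open>
  The exponents are \<open>3 d\<close> and \<open>d\<close>, both with coefficient 1.
\<close>

lemma admissible_k_3:
  assumes "two_power_sum 3 d"
  shows "admissible 3 3 d"
  using assms two_power_sum_mult_iff[of 3 d] by (simp add: admissible_iff_indices lessThan_nat_numeral lessThan_Suc)

theorem theorem2p1:
  fixes p q e k d :: nat and a :: "'a::finite_field"
  assumes "prime p" and "odd p"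
    and "e > 0" and "q = p ^ e" and "card (UNIV :: 'a set) = q"
    and "a \<noteq> 0"
    and "k > 0" and "d > 0"
  shows "DO_poly p (dickson_frak d k 2 a) \<longleftrightarrow>
      (k = 1 \<and> (\<exists>\<alpha> n. d = p ^ n * (p ^ \<alpha> + 1)))
    \<or> (k = 2 \<and> (\<exists>\<alpha> n. d = (p ^ n * (p ^ \<alpha> + 1)) div 2))
    \<or> (k = 3 \<and> ((p = 3 \<and> (\<exists>\<alpha> n. d = p ^ n * (p ^ \<alpha> + 1)))
              \<or> (p = 5 \<and> (\<exists>n. d = 2 * p ^ n))))
    \<or> (k \<in> {4, 6, 12} \<and> p = 3 \<and> (\<exists>n. d = p ^ n))
    \<or> (k = 5 \<and> ((p = 3 \<and> (\<exists>n. d = 2 * p ^ n))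
              \<or> (p = 5 \<and> (\<exists>n. d = 2 * p ^ n))))
    \<or> (k = 9 \<and> p = 3 \<and> (\<exists>n. d = 4 * p ^ n))"
    (is "_ \<longleftrightarrow> ?R")
proof -
  note p = assms(1,2)
  have "DO_poly p (dickson_frak d k 2 a) \<longleftrightarrow> admissible p k d"
    using DO_poly_dickson_frak_iff_admissible[of p e a d k] assms by simp
  also have "\<dots> \<longleftrightarrow> ?R"
  proof
    assume adm: "admissible p k d"
    obtain d' where d': "d = p ^ multiplicity p d * d'" "\<not> p dvd d'"
      using multiplicity_decompose'[of d p] \<open>d > 0\<close> prime_gt_1_nat[OF p(1)] by auto
    define v where "v = multiplicity p d"
    have d: "d = p ^ v * d'"
      using d'(1) by (simp add: v_def)
    have adm': "admissible p k d'"
      using adm admissible_mult_power_iff[OF p] by (simp add: d)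
    show ?R
    proof (cases "odd k")
      case True
      show ?thesis
        using admissible_odd_classification[OF p True d'(2) adm'] unfolding d
        by (elim disjE conjE exE) (auto simp: mult.commute)
    next
      case False
      then consider \<alpha> where "k = 2" "2 * d' = p ^ \<alpha> + 1" | "k \<in> {4, 6, 12}" "p = 3" "d' = 1"
        using admissible_even_classification[OF p _ \<open>k > 0\<close> d'(2) adm'] by blast
      then show ?thesis
      proof cases
        case 1
        have "d = p ^ v * (2 * d') div 2"
          by (simp add: d)
        then have "d = p ^ v * (p ^ \<alpha> + 1) div 2"
          by (simp only: 1)
        with \<open>k = 2\<close> show ?thesis by blast
      next
        case 2
        then show ?thesis
          using d by auto
      qed
    qed
  next
    have pow: "two_power_sum p (p ^ n * (p ^ \<alpha> + 1))" for n \<alpha>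
      using two_power_sum_powers[of p "n + \<alpha>" n] by (simp add: power_add algebra_simps)
    have scale: "admissible p k (c * p ^ n)" if "admissible p k c" for c n
      using that admissible_mult_power_iff[OF p, of k n c] by (simp add: mult.commute)
    have half: "2 * (p ^ n * (p ^ \<alpha> + 1) div 2) = p ^ n * (p ^ \<alpha> + 1)" for n \<alpha>
      using p(2) by (intro dvd_mult_div_cancel) simp
    have scale1: "admissible p k (p ^ n)" if "admissible p k 1" for n
      using scale[OF that, of n] by simp
    have k1: "admissible p k d" if "k = 1" "d = p ^ n * (p ^ \<alpha> + 1)" for n \<alpha>
      using that pow[of n \<alpha>] by (simp only: admissible_k_1)
    have k2: "admissible p k d" if "k = 2" "d = p ^ n * (p ^ \<alpha> + 1) div 2" for n \<alpha>
      using that pow[of n \<alpha>] by (simp only: admissible_k_2 half)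
    have k3: "admissible p k d" if "k = 3" "p = 3" "d = p ^ n * (p ^ \<alpha> + 1)" for n \<alpha>
      using that pow[of n \<alpha>] by (simp only: admissible_k_3)
    have c1: "admissible p k d" if "k \<in> {4, 6, 12}" "p = 3" "d = p ^ n" for n
      using that scale1[of n] admissible_small by auto
    have c2: "admissible p k d" if "k = 5 \<and> (p = 3 \<or> p = 5) \<or> k = 3 \<and> p = 5" "d = 2 * p ^ n" for n
      using that scale[of 2 n] admissible_small by auto
    have c4: "admissible p k d" if "k = 9" "p = 3" "d = 4 * p ^ n" for n
      using that scale[of 4 n] admissible_small by auto
    assume ?R
    then show "admissible p k d"
      using k1 k2 k3 c1 c2 c4 by blast
  qed
  finally show ?thesis .
qed

end
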